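(* Let $0<X<1$ and $Y\ne0$ be real numbers. Then $$\prod_{i=1}^\infty\bigl(1-X^{2i}\bigr)\bigl(1+X^{2i-1}Y^2\bigr)\Bigl(1+\frac{X^{2i-1}}{Y^2}\Bigr)=\sum_{j=-\infty}^\infty X^{j^2}Y^{2j}.$$ *)

theory Defs
  imports "HOL-Analysis.Analysis"
begin

end

theory Submission
  imports Defs
begin

text \<open>
  The identity is the limit of a polynomial one. Put \<open>q = X\<^sup>2\<close>, \<open>z = Y\<^sup>2\<close> and
  \<open>[n]! = (1 - q) \<dots> (1 - q\<^sup>n)\<close>. The product of the first \<open>n\<close> factors is a Laurent polynomial
  in \<open>z\<close>, and its coefficient at \<open>z\<^sup>j\<close> is \<open>X\<close> to the power \<open>j\<^sup>2\<close> times
  \[ c_n(j) = \frac{[2n]!\,[n]!}{[n+j]!\,[n-j]!}, \]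
  that is, \<open>[n]!\<close> times a Gaussian binomial coefficient. This is proved by induction on \<open>n\<close>
  (\<open>finite_triple_product\<close>): multiplying by the next factor mixes the coefficients at \<open>j\<close>,
  \<open>j - 1\<close> and \<open>j + 1\<close>, and \<open>triple_coeff_Suc\<close> is the resulting three-term recursion.

  For fixed \<open>j\<close>, \<open>c_n(j)\<close> tends to \<open>1\<close>, since \<open>[n]!\<close> converges to a nonzero limit. Moreover
  \<open>0 \<le> c_n(j) \<le> 1\<close>, since \<open>[n]!\<close> decreases in \<open>n\<close>. So the summands of the finite identities are
  nonnegative, lie below the summands of the bilateral series, and converge to them. Under these
  conditions the limit may be taken termwise (\<open>has_sum_pointwise_limit_from_below\<close>), and
  summability of the bilateral series comes out along the way, because every finite partial sum is
  bounded by the value of the product.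
\<close>

section \<open>The \<open>q\<close>-factorial and its reciprocal\<close>

definition qfact :: "real \<Rightarrow> nat \<Rightarrow> real" where
  "qfact q n = (\<Prod>i<n. 1 - q ^ Suc i)"

text \<open>
  The value \<open>0\<close> at negative arguments is the one that keeps the recursion \<open>inv_qfact_pred\<close> valid
  on all of \<open>\<int>\<close>. With it, the coefficients below vanish by themselves outside \<open>\<bar>j\<bar> \<le> n\<close>, and sums
  over \<open>j\<close> can run over all integers and be shifted freely.
\<close>
definition inv_qfact :: "real \<Rightarrow> int \<Rightarrow> real" where
  "inv_qfact q m = (if m < 0 then 0 else 1 / qfact q (nat m))"

text \<open>
  \<open>[n]!\<close> times the Gaussian binomial coefficient \<open>2n\<close> choose \<open>n + j\<close>.
\<close>
definition triple_coeff :: "real \<Rightarrow> nat \<Rightarrow> int \<Rightarrow> real" where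
  "triple_coeff q n j =
     qfact q (2 * n) * qfact q n * inv_qfact q (int n + j) * inv_qfact q (int n - j)"

lemma qfact_Suc: "qfact q (Suc n) = qfact q n * (1 - q ^ Suc n)"
  by (simp add: qfact_def)

context
  fixes q :: real
  assumes q: "0 < q" "q < 1"
begin

lemma qfact_factor_pos: "0 < 1 - q ^ Suc i"
  using q power_Suc_less_one[of q i] by simp

lemma qfact_pos: "0 < qfact q n"
  unfolding qfact_def using qfact_factor_pos by (intro prod_pos) blast

lemma qfact_antimono: "m \<le> n \<Longrightarrow> qfact q n \<le> qfact q m"
proof (rule lift_Suc_antimono_le)
  fix n show "qfact q (Suc n) \<le> qfact q n"
    unfolding qfact_Suc using qfact_pos[of n] q by (intro mult_left_le) auto
qed

text \<open>
  What matters is that the limit is nonzero, so that quotients of \<open>q\<close>-factorials converge too.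
\<close>
lemma qfact_tendsto: "\<exists>l>0. qfact q \<longlonglongrightarrow> l"
proof -
  have "summable (\<lambda>i. norm ((1 - q ^ Suc i) - 1))"
    using q by (simp add: summable_mult summable_geometric)
  then have conv: "convergent_prod (\<lambda>i. 1 - q ^ Suc i)"
    by (intro abs_convergent_prod_imp_convergent_prod summable_imp_abs_convergent_prod)
  then have "0 < (\<Prod>i. 1 - q ^ Suc i)"
    by (intro less_0_prodinf qfact_factor_pos)
  moreover have "qfact q \<longlonglongrightarrow> (\<Prod>i. 1 - q ^ Suc i)"
    using convergent_prod_LIMSEQ[OF conv] unfolding LIMSEQ_lessThan_iff_atMost[symmetric]
    by (simp add: qfact_def[abs_def])
  ultimately show ?thesis by blast
qed

text \<open>
  At \<open>m = 0\<close> both sides vanish: the left by the convention for negative arguments, the right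
  because of the factor \<open>1 - q\<^sup>0\<close>.
\<close>
lemma inv_qfact_pred: "inv_qfact q (m - 1) = (1 - q powi m) * inv_qfact q m"
proof (cases "m \<le> 0")
  case True
  then show ?thesis by (cases "m = 0") (auto simp: inv_qfact_def)
next
  case False
  then obtain k where k: "m = int (Suc k)"
    by (metis not_le zero_less_imp_eq_int gr0_implies_Suc)
  have "nat (1 + int k) = Suc k" by simp
  then show ?thesis
    using qfact_factor_pos[of k] qfact_pos[of k] unfolding k
    by (simp add: inv_qfact_def qfact_Suc power_int_def del: power_Suc)
qed

lemma triple_coeff_nonneg: "0 \<le> triple_coeff q n j"
  using qfact_pos by (auto simp: triple_coeff_def inv_qfact_def intro!: mult_nonneg_nonneg less_imp_le)

text \<open>
  For \<open>\<bar>j\<bar> \<le> n\<close> (otherwise the coefficient is \<open>0\<close>): of the two indices \<open>n + j\<close> and \<open>n - j\<close>, both are at most \<open>2n\<close> and one is at most \<open>n\<close>, so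
  monotonicity compares the denominator with the numerator factor by factor.
\<close>
lemma triple_coeff_le_1: "triple_coeff q n j \<le> 1"
proof (cases "\<bar>j\<bar> \<le> int n")
  case False
  then show ?thesis by (auto simp: triple_coeff_def inv_qfact_def)
next
  case True
  have *: "qfact q (2 * n) * qfact q n \<le> qfact q a * qfact q b"
    if "a \<le> 2 * n" "b \<le> n" for a b
    using that qfact_pos by (intro mult_mono qfact_antimono) (auto intro: less_imp_le)
  define a b where "a = nat (int n + j)" and "b = nat (int n - j)"
  have "qfact q (2 * n) * qfact q n \<le> qfact q a * qfact q b"
  proof (cases "j \<ge> 0")
    case True
    then show ?thesis using \<open>\<bar>j\<bar> \<le> int n\<close> by (intro *) (auto simp: a_def b_def)
  next
    case False
    then show ?thesis using \<open>\<bar>j\<bar> \<le> int n\<close> 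
      by (subst mult.commute[of "qfact q a"], intro *) (auto simp: a_def b_def)
  qed
  moreover have "triple_coeff q n j = qfact q (2 * n) * qfact q n / (qfact q a * qfact q b)"
    using True by (auto simp: triple_coeff_def inv_qfact_def a_def b_def)
  ultimately show ?thesis
    using qfact_pos[of a] qfact_pos[of b] by simp
qed

lemma triple_coeff_tendsto: "(\<lambda>n. triple_coeff q n j) \<longlonglongrightarrow> 1"
proof -
  obtain l where l: "l > 0" "qfact q \<longlonglongrightarrow> l"
    using qfact_tendsto by blast
  have inv: "(\<lambda>n. inv_qfact q (int n + k)) \<longlonglongrightarrow> 1 / l" for k
  proof -
    have "filterlim (\<lambda>n. nat (int n + k)) sequentially sequentially"
      unfolding filterlim_at_top eventually_sequentially
    proof
      fix Z show "\<exists>N. \<forall>n\<ge>N. Z \<le> nat (int n + k)"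
        by (intro exI[of _ "Z + nat \<bar>k\<bar>"]) auto
    qed
    then have "(\<lambda>n. 1 / qfact q (nat (int n + k))) \<longlonglongrightarrow> 1 / l"
      using l by (intro tendsto_intros filterlim_compose[OF l(2)]) auto
    moreover have "eventually (\<lambda>n. 1 / qfact q (nat (int n + k)) = inv_qfact q (int n + k)) sequentially"
      using eventually_ge_at_top[of "nat \<bar>k\<bar>"] by eventually_elim (auto simp: inv_qfact_def)
    ultimately show ?thesis
      by (rule Lim_transform_eventually)
  qed
  have "filterlim (\<lambda>n. 2 * n) sequentially (sequentially :: nat filter)"
    by (rule filterlim_subseq) (auto simp: strict_mono_def)
  then have double: "(\<lambda>n. qfact q (2 * n)) \<longlonglongrightarrow> l"
    by (rule filterlim_compose[OF l(2)])
  have "(\<lambda>n. triple_coeff q n j) \<longlonglongrightarrow> l * l * (1 / l) * (1 / l)"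
    using inv[of j] inv[of "- j"] unfolding triple_coeff_def
    by (intro tendsto_mult double l(2)) simp_all
  then show ?thesis using l by simp
qed

text \<open>
  With \<open>u\<close> and \<open>v\<close> the powers of \<open>q\<close> with exponents \<open>n + 1 + j\<close> and \<open>n + 1 - j\<close>, every
  coefficient involved is a common factor times a polynomial in \<open>u\<close>, \<open>v\<close> and \<open>1 / q\<close>; the powers
  of \<open>q\<close> that depend on \<open>n\<close> alone are expressed through \<open>u v\<close>. The recursion thus becomes a
  polynomial identity.
\<close>
lemma triple_coeff_Suc:
  "triple_coeff q (Suc n) j = (1 - q ^ Suc n) *
     ((1 + q ^ (2 * n + 1)) * triple_coeff q n j
      + q powi (int n + 1 - j) * triple_coeff q n (j - 1)
      + q powi (int n + 1 + j) * triple_coeff q n (j + 1))"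
proof -
  define u v where "u = q powi (int n + 1 + j)" and "v = q powi (int n + 1 - j)"
  define A B where "A = inv_qfact q (int n + 1 + j)" and "B = inv_qfact q (int n + 1 - j)"
  have uv: "q ^ (2 * n + 2) = u * v"
  proof -
    have "u * v = q powi (int (2 * n + 2))"
      using q by (simp add: u_def v_def algebra_simps flip: power_int_add)
    then show ?thesis by (simp only: power_int_of_nat)
  qed
  then have uv': "q ^ (2 * n + 1) = u * v / q"
    using q by (simp add: field_simps)
  have uq: "q powi (int n + j) = u / q" and vq: "q powi (int n - j) = v / q"
    using q by (simp_all add: u_def v_def flip: power_int_diff)
       (simp_all add: power_int_diff power_int_add field_simps)
  have A1: "inv_qfact q (int n + j) = (1 - u) * A"
    using inv_qfact_pred[of "int n + 1 + j"] by (simp add: A_def u_def algebra_simps)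
  have A2: "inv_qfact q (int n + (j - 1)) = (1 - u / q) * ((1 - u) * A)"
    using inv_qfact_pred[of "int n + j"] by (simp only: A1 uq add_diff_eq)
  have B1: "inv_qfact q (int n - j) = (1 - v) * B"
    using inv_qfact_pred[of "int n + 1 - j"] by (simp add: B_def v_def algebra_simps)
  have B2: "inv_qfact q (int n - (j + 1)) = (1 - v / q) * ((1 - v) * B)"
    using inv_qfact_pred[of "int n - j"] by (simp only: B1 vq diff_diff_eq)
  have A0: "inv_qfact q (int n + (j + 1)) = A" "inv_qfact q (int (Suc n) + j) = A"
    and B0: "inv_qfact q (int n - (j - 1)) = B" "inv_qfact q (int (Suc n) - j) = B"
    by (simp_all add: A_def B_def algebra_simps)
  have P: "qfact q (2 * Suc n) = qfact q (2 * n) * (1 - u * v / q) * (1 - u * v)"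
    using uv uv' by (simp add: qfact_Suc)
  have key: "(1 - u * v / q) * (1 - u * v) =
      (1 + u * v / q) * ((1 - u) * (1 - v)) + v * ((1 - u / q) * (1 - u)) + u * ((1 - v / q) * (1 - v))"
    using q by (simp add: field_simps)
  have "triple_coeff q (Suc n) j =
      (1 - q ^ Suc n) * (qfact q (2 * n) * qfact q n * A * B) * ((1 - u * v / q) * (1 - u * v))"
    unfolding triple_coeff_def P A0 B0 qfact_Suc[of q n] by (simp only: mult_ac)
  then show ?thesis
    unfolding key triple_coeff_def A0 A1 A2 B0 B1 B2 uv' u_def[symmetric] v_def[symmetric]
    by (simp only: distrib_left distrib_right mult_ac)
qed

end

section \<open>The finite triple product\<close>

text \<open>
  As the coefficients have finite support, the sum over all integers is in fact a finite sum.
  In the induction step the part of the new factor that depends on \<open>z\<close> is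
  \<open>(1 + x z) (1 + x / z) = (1 + x\<^sup>2) + x z + x / z\<close>, where \<open>x\<close> is the power of \<open>X\<close> with exponent
  \<open>2n + 1\<close>. Multiplication by \<open>z\<close> or \<open>1 / z\<close> shifts the index, and moving the quadratic exponent
  from \<open>(j \<plusminus> 1)\<^sup>2\<close> to \<open>j\<^sup>2\<close> produces exactly the powers of \<open>q\<close> in \<open>triple_coeff_Suc\<close>.
\<close>
lemma finite_triple_product:
  fixes X z :: real
  assumes X: "0 < X" "X < 1" and z: "z \<noteq> 0"
  shows "((\<lambda>j. triple_coeff (X\<^sup>2) n j * (X powi j\<^sup>2 * z powi j)) has_sum
          (\<Prod>i<n. (1 - X ^ (2 * Suc i)) * (1 + X ^ (2 * Suc i - 1) * z)
                  * (1 + X ^ (2 * Suc i - 1) / z))) UNIV"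
proof (induction n)
  case 0
  have "0 < X\<^sup>2" "X\<^sup>2 < 1"
    using X by (auto simp: power_less_one_iff)
  then have "triple_coeff (X\<^sup>2) 0 j = (if j = 0 then 1 else 0)" for j
    by (auto simp: triple_coeff_def inv_qfact_def qfact_def)
  then show ?case
    by (intro has_sum_finite_neutralI[of "{0}"]) auto
next
  case (Suc n)
  have q: "0 < X\<^sup>2" "X\<^sup>2 < 1"
    using X by (auto simp: power_less_one_iff)
  define w where "w j = X powi j\<^sup>2 * z powi j" for j :: int
  define t where "t n j = triple_coeff (X\<^sup>2) n j * w j" for n j
  define F where "F = (\<Prod>i<n. (1 - X ^ (2 * Suc i)) * (1 + X ^ (2 * Suc i - 1) * z)
                  * (1 + X ^ (2 * Suc i - 1) / z))"
  define x where "x = X ^ (2 * n + 1)"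
  have F: "(t n has_sum F) UNIV"
    using Suc.IH by (simp add: t_def[abs_def] w_def F_def)
  have down: "((\<lambda>j. t n (j - 1)) has_sum F) UNIV"
    using F by (subst has_sum_reindex_bij_witness[of _ "\<lambda>j. j + 1" "\<lambda>j. j - 1"]) auto
  have up: "((\<lambda>j. t n (j + 1)) has_sum F) UNIV"
    using F by (subst has_sum_reindex_bij_witness[of _ "\<lambda>j. j - 1" "\<lambda>j. j + 1"]) auto
  have sq: "X\<^sup>2 powi m = X powi (2 * m)" for m :: int
    by (simp add: power_int_mult)
  have w_down: "(X\<^sup>2) powi (int n + 1 - j) * w j = x * z * w (j - 1)" for j
  proof -
    have "X powi (2 * (int n + 1 - j) + j\<^sup>2) = X powi (int (2 * n + 1) + (j - 1)\<^sup>2)"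
      by (rule arg_cong[of _ _ "power_int X"]) (simp add: power2_eq_square algebra_simps)
    then have "X powi (2 * (int n + 1 - j)) * X powi j\<^sup>2 = x * X powi (j - 1)\<^sup>2"
      using X unfolding x_def by (subst (asm) (1 2) power_int_add) (auto simp only: power_int_of_nat)
    moreover have "z powi j = z * z powi (j - 1)"
      using z by (simp add: power_int_diff)
    ultimately show ?thesis by (simp add: w_def sq)
  qed
  have w_up: "(X\<^sup>2) powi (int n + 1 + j) * w j = x / z * w (j + 1)" for j
  proof -
    have "X powi (2 * (int n + 1 + j) + j\<^sup>2) = X powi (int (2 * n + 1) + (j + 1)\<^sup>2)"
      by (rule arg_cong[of _ _ "power_int X"]) (simp add: power2_eq_square algebra_simps)
    then have "X powi (2 * (int n + 1 + j)) * X powi j\<^sup>2 = x * X powi (j + 1)\<^sup>2"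
      using X unfolding x_def by (subst (asm) (1 2) power_int_add) (auto simp only: power_int_of_nat)
    moreover have "z powi (j + 1) = z * z powi j"
      using z by (simp add: power_int_add)
    ultimately show ?thesis using z by (simp add: w_def sq)
  qed
  have x2: "(X\<^sup>2) ^ (2 * n + 1) = x * x"
    unfolding x_def by (simp flip: power_mult power_add)
  have t_Suc: "t (Suc n) j =
      (1 - X ^ (2 * Suc n)) * ((1 + x * x) * t n j + x * z * t n (j - 1) + x / z * t n (j + 1))" for j
  proof -
    have "t (Suc n) j = (1 - (X\<^sup>2) ^ Suc n) * ((1 + x * x) * t n j
        + triple_coeff (X\<^sup>2) n (j - 1) * ((X\<^sup>2) powi (int n + 1 - j) * w j)
        + triple_coeff (X\<^sup>2) n (j + 1) * ((X\<^sup>2) powi (int n + 1 + j) * w j))"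
      unfolding t_def triple_coeff_Suc[OF q] x2 by (simp only: distrib_left distrib_right mult_ac)
    then show ?thesis
      unfolding w_down w_up t_def power_mult by (simp only: mult_ac)
  qed
  have "(t (Suc n) has_sum (1 - X ^ (2 * Suc n)) * ((1 + x * x) * F + x * z * F + x / z * F)) UNIV"
    unfolding t_Suc by (intro has_sum_cmult_right has_sum_add F down up)
  also have "(1 - X ^ (2 * Suc n)) * ((1 + x * x) * F + x * z * F + x / z * F) =
      F * ((1 - X ^ (2 * Suc n)) * (1 + x * z) * (1 + x / z))"
    using z by (simp add: field_simps)
  also have "\<dots> = (\<Prod>i<Suc n. (1 - X ^ (2 * Suc i)) * (1 + X ^ (2 * Suc i - 1) * z)
                  * (1 + X ^ (2 * Suc i - 1) / z))"
    by (simp add: F_def x_def)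
  finally show ?case
    by (simp add: t_def[abs_def] w_def)
qed

section \<open>Passage to the limit\<close>

text \<open>
  A form of dominated convergence in which the limit function is itself the dominating function.
  It is summable because each of its finite partial sums is the limit of partial sums of the
  \<open>f n\<close>, which are at most \<open>F n\<close>, and is therefore at most \<open>L\<close>. The reverse bound
  \<open>F n \<le> \<Sum>g\<close> then identifies the sum.
\<close>
lemma has_sum_pointwise_limit_from_below:
  fixes f :: "nat \<Rightarrow> 'a \<Rightarrow> real"
  assumes sum: "\<And>n. (f n has_sum F n) A"
    and nonneg: "\<And>n x. x \<in> A \<Longrightarrow> 0 \<le> f n x"
    and le: "\<And>n x. x \<in> A \<Longrightarrow> f n x \<le> g x"
    and lim: "\<And>x. x \<in> A \<Longrightarrow> (\<lambda>n. f n x) \<longlonglongrightarrow> g x"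
    and F: "F \<longlonglongrightarrow> L"
  shows "(g has_sum L) A"
proof -
  have g_nonneg: "0 \<le> g x" if "x \<in> A" for x
    using nonneg[OF that] le[OF that] by (meson order_trans)
  have finite_le: "sum g B \<le> L" if "finite B" "B \<subseteq> A" for B
  proof (rule LIMSEQ_le)
    show "(\<lambda>n. sum (f n) B) \<longlonglongrightarrow> sum g B"
      using that by (intro tendsto_sum lim) auto
    show "\<exists>N. \<forall>n\<ge>N. sum (f n) B \<le> F n"
      using that nonneg sum by (intro exI allI impI finite_sum_le_has_sum) auto
  qed (rule F)
  have summ: "g summable_on A"
    using g_nonneg finite_le by (intro nonneg_bdd_above_summable_on bdd_aboveI[of _ L]) auto
  have "infsum g A \<le> L"
    using finite_le by (intro infsum_le_finite_sums summ)
  moreover have "F n \<le> infsum g A" for n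
    using sum[of n] has_sum_infsum[OF summ] le by (rule has_sum_mono)
  then have "L \<le> infsum g A"
    using F by (intro LIMSEQ_le_const2) auto
  ultimately show ?thesis
    using summ by (metis has_sum_infsum order_antisym)
qed

lemma convergent_triple_product:
  fixes X z :: real
  assumes X: "0 < X" "X < 1"
  shows "convergent_prod (\<lambda>i. (1 - X ^ (2 * Suc i)) * (1 + X ^ (2 * Suc i - 1) * z)
                  * (1 + X ^ (2 * Suc i - 1) / z))"
proof -
  have *: "convergent_prod (\<lambda>i. 1 + c * (X\<^sup>2) ^ i)" for c
  proof -
    have "norm (X\<^sup>2) < 1"
      using X by (auto simp: power_less_one_iff)
    then have "summable (\<lambda>i. \<bar>c\<bar> * (X\<^sup>2) ^ i)"
      by (intro summable_mult summable_geometric)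
    then show ?thesis
      by (intro abs_convergent_prod_imp_convergent_prod summable_imp_abs_convergent_prod)
         (simp add: abs_mult)
  qed
  have "convergent_prod (\<lambda>i. (1 + (- X\<^sup>2) * (X\<^sup>2) ^ i) * (1 + (X * z) * (X\<^sup>2) ^ i)
          * (1 + (X / z) * (X\<^sup>2) ^ i))"
    by (intro convergent_prod_mult *)
  also have "(\<lambda>i. (1 + (- X\<^sup>2) * (X\<^sup>2) ^ i) * (1 + (X * z) * (X\<^sup>2) ^ i)
          * (1 + (X / z) * (X\<^sup>2) ^ i)) = (\<lambda>i. (1 - X ^ (2 * Suc i)) * (1 + X ^ (2 * Suc i - 1) * z)
                  * (1 + X ^ (2 * Suc i - 1) / z))"
    by (simp add: power_mult power2_eq_square power_mult_distrib mult_ac)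
  finally show ?thesis .
qed

theorem theorem3p5:
  fixes X Y :: real
  assumes "0 < X" and "X < 1" and "Y \<noteq> 0"
  shows "convergent_prod (\<lambda>n. let i = Suc n in
             (1 - X ^ (2 * i)) * (1 + X ^ (2 * i - 1) * Y ^ 2) * (1 + X ^ (2 * i - 1) / Y ^ 2))
       \<and> (\<lambda>j::int. X powi (j ^ 2) * Y powi (2 * j)) summable_on UNIV
       \<and> (\<Prod>n. let i = Suc n in
             (1 - X ^ (2 * i)) * (1 + X ^ (2 * i - 1) * Y ^ 2) * (1 + X ^ (2 * i - 1) / Y ^ 2))
         = (\<Sum>\<^sub>\<infinity>j::int. X powi (j ^ 2) * Y powi (2 * j))"
proof -
  define f where "f i = (1 - X ^ (2 * Suc i)) * (1 + X ^ (2 * Suc i - 1) * Y\<^sup>2)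
                  * (1 + X ^ (2 * Suc i - 1) / Y\<^sup>2)" for i
  define g where "g j = X powi j\<^sup>2 * (Y\<^sup>2) powi j" for j :: int
  have q: "0 < X\<^sup>2" "X\<^sup>2 < 1"
    using assms by (auto simp: power_less_one_iff)
  have g_nonneg: "0 \<le> g j" for j
    using assms by (simp add: g_def)
  have conv: "convergent_prod f"
    unfolding f_def using assms by (intro convergent_triple_product) auto
  have "(g has_sum prodinf f) UNIV"
  proof (rule has_sum_pointwise_limit_from_below)
    show "((\<lambda>j. triple_coeff (X\<^sup>2) n j * g j) has_sum (\<Prod>i<n. f i)) UNIV" for n
      unfolding f_def g_def using assms by (intro finite_triple_product) auto
    show "0 \<le> triple_coeff (X\<^sup>2) n j * g j" for n j
      using triple_coeff_nonneg[OF q] g_nonneg by (rule mult_nonneg_nonneg)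
    show "triple_coeff (X\<^sup>2) n j * g j \<le> g j" for n j
      using triple_coeff_le_1[OF q] g_nonneg by (metis mult_right_mono mult_1)
    show "(\<lambda>n. triple_coeff (X\<^sup>2) n j * g j) \<longlonglongrightarrow> g j" for j
      using tendsto_mult_right[OF triple_coeff_tendsto[OF q]] by (metis mult_1)
    show "(\<lambda>n. \<Prod>i<n. f i) \<longlonglongrightarrow> prodinf f"
      using convergent_prod_LIMSEQ[OF conv] unfolding LIMSEQ_lessThan_iff_atMost .
  qed
  moreover have "g = (\<lambda>j. X powi (j ^ 2) * Y powi (2 * j))"
    by (simp add: g_def[abs_def] power_int_mult)
  ultimately show ?thesis
    using conv by (auto simp: f_def[abs_def] Let_def has_sum_imp_summable infsumI)
qed

end
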